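(* Let $\Gamma\subseteq T\mathbb{S}^n$ be an isotropic immersed submanifold with $\dim\Gamma>0$. Suppose that $p\in\Psi(\Gamma\times\mathbb{R})$ is not a focal point of $\Gamma$, and write $p=\Psi((\xi_0,\eta_0),r_0)$ with $((\xi_0,\eta_0),r_0)\in\Gamma\times\mathbb{R}$. Then $p$ is contained in an orthogonal submanifold of $\Gamma$ of dimension $\dim\Gamma$ which takes the form $$\Sigma_0:=\Psi\Big(\big\{((\xi,\eta),F(\xi,\eta)):(\xi,\eta)\in W\big\}\Big),$$ with $W\subset\Gamma$ open and $F:W\to\mathbb{R}$ a smooth function such that $\theta=\mathrm{d}F$ on $W$ and $F(\xi_0,\eta_0)=r_0$.
   Context: "Smooth" means $C^2$. $\langle\cdot,\cdot\rangle$ is the Euclidean inner product. A subset $\mathcal N$ of a manifold $\mathcal M$ is immersed if $\mathcal N$ itself is a smooth manifold and the inclusion is a smooth immersion. Identify $T\mathbb{S}^n=\{(\xi,\eta)\in\mathbb{R}^{n+1}\times\mathbb{R}^{n+1}: |\xi|=1,\ \langle\xi,\eta\rangle=0\}$; $(\xi,\eta)$ corresponds to the oriented line $\{\eta+t\xi:t\in\mathbb{R}\}$. $\Psi:T\mathbb{S}^n\times\mathbb{R}\to\mathbb{R}^{n+1}$ is $\Psi((\xi,\eta),r)=\eta+r\xi$. Let $g$ be the round metric on $\mathbb{S}^n$ and $\pi:T\mathbb{S}^n\to\mathbb{S}^n$ the projection; the Liouville form is $\theta_{(\xi,\eta)}(X)=g_\xi(\mathrm{d}\pi(X),\eta)$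 and $\Omega=-\mathrm{d}\theta$. $\Gamma$ is isotropic if $\Omega|_\Gamma=0$. A focal point of $\Gamma$ is a point $p\in\Psi(\Gamma\times\mathbb{R})$ such that $\Psi|_{\Gamma\times\mathbb{R}}$ fails to be an immersion at some point of $\Psi^{-1}(p)$. For a unit section $\nu$ of $T\mathbb{R}^{n+1}$ over $\Sigma$, $\Phi_\nu(q)=(\nu(q),q-\langle\nu(q),q\rangle\nu(q))\in T\mathbb{S}^n$. An immersed submanifold $\Sigma\subset\mathbb{R}^{n+1}$ is an orthogonal submanifold of $\Gamma$ if $\dim\Sigma>0$ and there exists a smooth unit normal section $\nu\in\Gamma(N\Sigma)$ with $\Phi_\nu(\Sigma)\subseteq\Gamma$. *)

theory Defs
  imports "HOL-Analysis.Analysis"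
begin

definition C1_on :: "'a::euclidean_space set \<Rightarrow> ('a \<Rightarrow> 'b::real_normed_vector) \<Rightarrow> bool" where
  "C1_on S f \<longleftrightarrow>
     (\<exists>f' :: 'a \<Rightarrow> 'a \<Rightarrow>\<^sub>L 'b.
        (\<forall>x\<in>S. (f has_derivative blinfun_apply (f' x)) (at x)) \<and> continuous_on S f')"

definition C2_on :: "'a::euclidean_space set \<Rightarrow> ('a \<Rightarrow> 'b::real_normed_vector) \<Rightarrow> bool" where
  "C2_on S f \<longleftrightarrow>
     (\<exists>f' :: 'a \<Rightarrow> 'a \<Rightarrow>\<^sub>L 'b.
        (\<forall>x\<in>S. (f has_derivative blinfun_apply (f' x)) (at x)) \<and> C1_on S f')"

text \<open>
  An atlas is a set of charts \<open>(U, \<phi>)\<close> with values in the model space \<open>'m\<close>; the dimension of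
  the manifold is \<open>DIM('m)\<close>. The inverse chart is \<open>inv_into U \<phi>\<close>. The topology is a separate
  datum because an immersed submanifold need not carry the subspace topology.
\<close>

type_synonym ('p, 'm) atlas = "('p set \<times> ('p \<Rightarrow> 'm)) set"

definition C2_manifold :: "'p topology \<Rightarrow> ('p, 'm::euclidean_space) atlas \<Rightarrow> bool" where
  "C2_manifold T A \<longleftrightarrow>
     Hausdorff_space T \<and> second_countable T \<and>
     (\<Union>(U, \<phi>)\<in>A. U) = topspace T \<and>
     (\<forall>(U, \<phi>)\<in>A. openin T U \<and> open (\<phi> ` U) \<and>
        homeomorphic_map (subtopology T U) (top_of_set (\<phi> ` U)) \<phi>) \<and>
     (\<forall>(U, \<phi>)\<in>A. \<forall>(V, \<psi>)\<in>A. C2_on (\<phi> ` (U \<inter> V)) (\<psi> \<circ> inv_into U \<phi>))"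

definition smooth_on ::
    "('p, 'm::euclidean_space) atlas \<Rightarrow> 'p set \<Rightarrow> ('p \<Rightarrow> 'b::real_normed_vector) \<Rightarrow> bool" where
  "smooth_on A W f \<longleftrightarrow> (\<forall>(U, \<phi>)\<in>A. C2_on (\<phi> ` (U \<inter> W)) (f \<circ> inv_into U \<phi>))"

text \<open>The differential of \<open>f\<close> at \<open>q\<close>, read in the chart \<open>(U, \<phi>)\<close>.\<close>

definition differential ::
    "'p set \<Rightarrow> ('p \<Rightarrow> 'm::euclidean_space) \<Rightarrow> ('p \<Rightarrow> 'b::real_normed_vector) \<Rightarrow> 'p \<Rightarrow> 'm \<Rightarrow> 'b" where
  "differential U \<phi> f q = frechet_derivative (f \<circ> inv_into U \<phi>) (at (\<phi> q))"

definition immersion_at ::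
    "('p, 'm::euclidean_space) atlas \<Rightarrow> ('p \<Rightarrow> 'b::real_normed_vector) \<Rightarrow> 'p \<Rightarrow> bool" where
  "immersion_at A f q \<longleftrightarrow> (\<forall>(U, \<phi>)\<in>A. q \<in> U \<longrightarrow> inj (differential U \<phi> f q))"

text \<open>
  Immersed submanifolds of a Euclidean space. Those of an embedded submanifold \<open>M\<close> (such as the
  tangent bundle of the sphere below) are the ones contained in \<open>M\<close>: a map into \<open>M\<close> is a
  C2 immersion if and only if it is one as a map into the ambient space.
\<close>

definition immersed_submanifold ::
    "'b::euclidean_space set \<Rightarrow> 'b topology \<Rightarrow> ('b, 'm::euclidean_space) atlas \<Rightarrow> bool" where
  "immersed_submanifold N T A \<longleftrightarrow>
     topspace T = N \<and> C2_manifold T A \<and>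
     smooth_on A N (\<lambda>q. q) \<and> (\<forall>q\<in>N. immersion_at A (\<lambda>q. q) q)"

text \<open>
  Tangent vectors of an immersed submanifold are identified with their images in the ambient
  space under the differential of the inclusion. All charts at \<open>q\<close> give the same image.
\<close>

definition tangent_space ::
    "('b, 'm::euclidean_space) atlas \<Rightarrow> 'b \<Rightarrow> 'b::euclidean_space set" where
  "tangent_space A q = (\<Union>(U, \<phi>)\<in>{(U, \<phi>)\<in>A. q \<in> U}. range (differential U \<phi> (\<lambda>q. q) q))"

text \<open>\<open>\<omega> = dF\<close> on \<open>W\<close>, for a one-form \<open>\<omega>\<close> on the ambient space pulled back to the submanifold.\<close>

definition is_differential_on ::
    "('b, 'm::euclidean_space) atlas \<Rightarrow> 'b::euclidean_space set \<Rightarrow> ('b \<Rightarrow> real) \<Rightarrow> ('b \<Rightarrow> 'b \<Rightarrow> real)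
      \<Rightarrow> bool" where
  "is_differential_on A W F \<omega> \<longleftrightarrow>
     (\<forall>(U, \<phi>)\<in>A. \<forall>q\<in>U \<inter> W. \<forall>v.
        \<omega> q (differential U \<phi> (\<lambda>q. q) q v) = differential U \<phi> F q v)"

definition times_line_atlas ::
    "('p, 'm::euclidean_space) atlas \<Rightarrow> ('p \<times> real, 'm \<times> real) atlas" where
  "times_line_atlas A = (\<lambda>(U, \<phi>). (U \<times> UNIV, map_prod \<phi> id)) ` A"

text \<open>
  Here \<open>'a\<close> is \<open>(n+1)\<close>-dimensional Euclidean space, so \<open>n = DIM('a) - 1\<close>. Points and tangent
  vectors of the tangent bundle of the unit sphere are represented in \<open>'a \<times> 'a\<close>, and the bundle
  projection is \<open>fst\<close>.
\<close>

definition TSphere :: "('a::euclidean_space \<times> 'a) set" where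
  "TSphere = {(\<xi>, \<eta>). norm \<xi> = 1 \<and> \<xi> \<bullet> \<eta> = 0}"

definition \<Psi> :: "('a::euclidean_space \<times> 'a) \<times> real \<Rightarrow> 'a" where
  "\<Psi> = (\<lambda>((\<xi>, \<eta>), r). \<eta> + r *\<^sub>R \<xi>)"

definition \<Phi> :: "('a::euclidean_space \<Rightarrow> 'a) \<Rightarrow> 'a \<Rightarrow> 'a \<times> 'a" where
  "\<Phi> \<nu> q = (\<nu> q, q - (\<nu> q \<bullet> q) *\<^sub>R \<nu> q)"

text \<open>
  The Liouville form is given by a formula that makes sense on all of \<open>'a \<times> 'a\<close>. Since exterior
  differentiation commutes with restriction, its exterior derivative on the tangent bundle of
  the sphere is the restriction, to tangent vectors, of the one computed in \<open>'a \<times> 'a\<close>.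
\<close>

definition liouville :: "'a::euclidean_space \<times> 'a \<Rightarrow> 'a \<times> 'a \<Rightarrow> real" where
  "liouville q X = frechet_derivative fst (at q) X \<bullet> snd q"

text \<open>
  The exterior derivative of a one-form on a vector space: the formula
  \<open>d\<omega>(X, Y) = X(\<omega>(Y)) - Y(\<omega>(X)) - \<omega>([X, Y])\<close> for constant fields.
\<close>

definition exterior_derivative :: "('b::euclidean_space \<Rightarrow> 'b \<Rightarrow> real) \<Rightarrow> 'b \<Rightarrow> 'b \<Rightarrow> 'b \<Rightarrow> real" where
  "exterior_derivative \<omega> q X Y =
     frechet_derivative (\<lambda>q. \<omega> q Y) (at q) X - frechet_derivative (\<lambda>q. \<omega> q X) (at q) Y"

definition symplectic_form :: "'a::euclidean_space \<times> 'a \<Rightarrow> 'a \<times> 'a \<Rightarrow> 'a \<times> 'a \<Rightarrow> real" where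
  "symplectic_form q X Y = - exterior_derivative liouville q X Y"

lemma liouville_eq: "liouville q X = fst X \<bullet> snd q"
  by (simp add: liouville_def frechet_derivative_at[OF has_derivative_fst[OF has_derivative_ident], symmetric])

lemma symplectic_form_eq: "symplectic_form q X Y = fst X \<bullet> snd Y - snd X \<bullet> fst Y"
proof -
  have "frechet_derivative (\<lambda>q. liouville q Z) (at q) = (\<lambda>h. fst Z \<bullet> snd h)"
    for Z :: "'a \<times> 'a"
  proof (rule frechet_derivative_at[symmetric])
    show "((\<lambda>q. liouville q Z) has_derivative (\<lambda>h. fst Z \<bullet> snd h)) (at q)"
      unfolding liouville_eq by (auto intro!: derivative_eq_intros)
  qed
  then show ?thesis
    by (simp add: symplectic_form_def exterior_derivative_def inner_commute)
qed

definition isotropic ::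
    "('a::euclidean_space \<times> 'a) set \<Rightarrow> ('a \<times> 'a, 'm::euclidean_space) atlas \<Rightarrow> bool" where
  "isotropic \<Gamma> A \<longleftrightarrow>
     (\<forall>q\<in>\<Gamma>. \<forall>X\<in>tangent_space A q. \<forall>Y\<in>tangent_space A q. symplectic_form q X Y = 0)"

definition focal_point ::
    "('a::euclidean_space \<times> 'a) set \<Rightarrow> ('a \<times> 'a, 'm::euclidean_space) atlas \<Rightarrow> 'a \<Rightarrow> bool" where
  "focal_point \<Gamma> A p \<longleftrightarrow>
     p \<in> \<Psi> ` (\<Gamma> \<times> UNIV) \<and>
     (\<exists>z\<in>\<Gamma> \<times> UNIV. \<Psi> z = p \<and> \<not> immersion_at (times_line_atlas A) \<Psi> z)"

definition orthogonal_submanifold ::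
    "('a::euclidean_space \<times> 'a) set \<Rightarrow> 'a set \<Rightarrow> 'a topology \<Rightarrow> ('a, 'm::euclidean_space) atlas \<Rightarrow> bool"
  where
  "orthogonal_submanifold \<Gamma> \<Sigma> S B \<longleftrightarrow>
     immersed_submanifold \<Sigma> S B \<and> DIM('m) > 0 \<and>
     (\<exists>\<nu>. smooth_on B \<Sigma> \<nu> \<and>
          (\<forall>q\<in>\<Sigma>. norm (\<nu> q) = 1 \<and> (\<forall>X\<in>tangent_space B q. \<nu> q \<bullet> X = 0)) \<and>
          \<Phi> \<nu> ` \<Sigma> \<subseteq> \<Gamma>)"

end

theory Submission
  imports Defs
begin

text \<open>
  Read in a chart around \<open>(\<xi>\<^sub>0, \<eta>\<^sub>0)\<close> with inverse \<open>h\<close>, the Liouville form becomes a closed C1 one-form on a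
  ball, because \<open>\<Gamma>\<close> is isotropic, so the Poincare lemma gives a C2 primitive \<open>f\<close> with value \<open>r\<^sub>0\<close> at the
  centre. The map \<open>G x = \<Psi> (h x, f x)\<close> is an immersion at the centre: its differential is the
  restriction of that of \<open>\<Psi>\<close> on \<open>\<Gamma> \<times> \<real>\<close>, which is injective since \<open>p\<close> is not focal, to the graph of
  the differential of \<open>f\<close>. On a smaller ball \<open>G\<close> is therefore an embedding. With \<open>G = \<eta> + f \<xi>\<close>,
  \<open>|\<xi>| = 1\<close> and \<open>\<langle>\<xi>, \<eta>\<rangle> = 0\<close> one finds \<open>\<langle>\<xi>, dG\<rangle> = \<langle>\<xi>, d\<eta>\<rangle> + df = - \<langle>d\<xi>, \<eta>\<rangle> + df = df - \<theta> = 0\<close>, so \<open>\<xi>\<close> is a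
  unit normal field along the image.
\<close>

section \<open>Calculus of C1 and C2 maps\<close>

lemma C1_onE:
  assumes "C1_on S f"
  obtains f' where "\<And>x. x \<in> S \<Longrightarrow> (f has_derivative blinfun_apply (f' x)) (at x)"
    and "continuous_on S f'"
  using assms unfolding C1_on_def by blast

lemma C1_onI:
  assumes "\<And>x. x \<in> S \<Longrightarrow> (f has_derivative blinfun_apply (f' x)) (at x)"
    and "continuous_on S f'"
  shows "C1_on S f"
  using assms unfolding C1_on_def by blast

lemma C2_onE:
  assumes "C2_on S f"
  obtains f' where "\<And>x. x \<in> S \<Longrightarrow> (f has_derivative blinfun_apply (f' x)) (at x)"
    and "C1_on S f'"
  using assms unfolding C2_on_def by blast

lemma C2_onI:
  assumes "\<And>x. x \<in> S \<Longrightarrow> (f has_derivative blinfun_apply (f' x)) (at x)"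
    and "C1_on S f'"
  shows "C2_on S f"
  using assms unfolding C2_on_def by blast

lemma C1_on_imp_continuous_on: "C1_on S f \<Longrightarrow> continuous_on S f"
  by (auto elim!: C1_onE intro!: continuous_at_imp_continuous_on has_derivative_continuous)

lemma C2_on_imp_C1_on: "C2_on S f \<Longrightarrow> C1_on S f"
  using C1_on_imp_continuous_on by (auto simp: C1_on_def[of S f] C2_on_def)

lemma C1_on_subset: "C1_on S f \<Longrightarrow> R \<subseteq> S \<Longrightarrow> C1_on R f"
  unfolding C1_on_def using continuous_on_subset by blast

lemma C2_on_subset: "C2_on S f \<Longrightarrow> R \<subseteq> S \<Longrightarrow> C2_on R f"
  unfolding C2_on_def using C1_on_subset by blast

lemma C2_on_cong:
  assumes "C2_on S f" "open S" "\<And>x. x \<in> S \<Longrightarrow> f x = g x"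
  shows "C2_on S g"
proof -
  obtain f' where "\<And>x. x \<in> S \<Longrightarrow> (f has_derivative blinfun_apply (f' x)) (at x)" and "C1_on S f'"
    using C2_onE[OF assms(1)] by blast
  then show ?thesis
    using has_derivative_transform_within_open[OF _ assms(2)] assms(3) by (intro C2_onI[of S g f']) blast+
qed

section \<open>Linear maps, sums, products and composites of C1 maps\<close>

lemma C1_on_linear:
  assumes L: "bounded_linear L" and f: "C1_on S f"
  shows "C1_on S (\<lambda>x. L (f x))"
proof -
  from f obtain f' where d: "\<And>x. x \<in> S \<Longrightarrow> (f has_derivative blinfun_apply (f' x)) (at x)"
    and c: "continuous_on S f'" by (rule C1_onE) blast
  show ?thesis
  proof (rule C1_onI)
    show "((\<lambda>x. L (f x)) has_derivative blinfun_apply (Blinfun L o\<^sub>L f' x)) (at x)" if "x \<in> S" for x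
      using bounded_linear.has_derivative[OF L d[OF that]]
      by (simp add: bounded_linear_Blinfun_apply[OF L] blinfun_compose.rep_eq o_def)
    show "continuous_on S (\<lambda>x. Blinfun L o\<^sub>L f' x)"
      by (intro continuous_intros c)
  qed
qed

lemma C1_on_add:
  assumes "C1_on S f" "C1_on S g"
  shows "C1_on S (\<lambda>x. f x + g x)"
proof -
  obtain f' where df: "\<And>x. x \<in> S \<Longrightarrow> (f has_derivative blinfun_apply (f' x)) (at x)"
    and cf: "continuous_on S f'" using C1_onE[OF assms(1)] by blast
  obtain g' where dg: "\<And>x. x \<in> S \<Longrightarrow> (g has_derivative blinfun_apply (g' x)) (at x)"
    and cg: "continuous_on S g'" using C1_onE[OF assms(2)] by blast
  show ?thesis
  proof (rule C1_onI)
    show "((\<lambda>x. f x + g x) has_derivative blinfun_apply (f' x + g' x)) (at x)" if "x \<in> S" for x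
      using has_derivative_add[OF df[OF that] dg[OF that]]
      by (simp add: plus_blinfun.rep_eq)
  qed (intro continuous_intros cf cg)
qed

text \<open>The product rule is written as an identity between bounded operators rather than
  pointwise in a vector: the derivative is then an operator-valued map built from \<open>f'\<close>,
  \<open>g'\<close>, \<open>f\<close>, \<open>g\<close> by bounded operations, and its continuity
  can be read off.\<close>

lemma C1_on_bilinear:
  assumes B: "bounded_bilinear mul" and f: "C1_on S f" and g: "C1_on S g"
  shows "C1_on S (\<lambda>x. mul (f x) (g x))"
proof -
  obtain f' where df: "\<And>x. x \<in> S \<Longrightarrow> (f has_derivative blinfun_apply (f' x)) (at x)"
    and cf: "continuous_on S f'" using C1_onE[OF f] by blast
  obtain g' where dg: "\<And>x. x \<in> S \<Longrightarrow> (g has_derivative blinfun_apply (g' x)) (at x)"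
    and cg: "continuous_on S g'" using C1_onE[OF g] by blast
  let ?D = "\<lambda>x. (bounded_bilinear.prod_right mul (f x) o\<^sub>L g' x) +
    (bounded_bilinear.prod_left mul (g x) o\<^sub>L f' x)"
  show ?thesis
  proof (rule C1_onI)
    show "((\<lambda>x. mul (f x) (g x)) has_derivative blinfun_apply (?D x)) (at x)" if "x \<in> S" for x
      using bounded_bilinear.FDERIV[OF B df[OF that] dg[OF that]]
      by (simp add: plus_blinfun.rep_eq blinfun_compose.rep_eq bounded_bilinear.prod_right.rep_eq[OF B]
          bounded_bilinear.prod_left.rep_eq[OF B] o_def)
    have "continuous_on S (\<lambda>x. bounded_bilinear.prod_right mul (f x))"
      "continuous_on S (\<lambda>x. bounded_bilinear.prod_left mul (g x))"
      using C1_on_imp_continuous_on[OF f] C1_on_imp_continuous_on[OF g]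
        bounded_bilinear.bounded_linear_prod_right[OF B] bounded_bilinear.bounded_linear_prod_left[OF B]
      by (auto intro: bounded_linear.continuous_on)
    then show "continuous_on S ?D"
      by (intro continuous_intros cf cg)
  qed
qed

lemma C1_on_compose:
  assumes g: "C1_on R g" and f: "C1_on S f" and "f ` S \<subseteq> R"
  shows "C1_on S (\<lambda>x. g (f x))"
proof -
  obtain f' where df: "\<And>x. x \<in> S \<Longrightarrow> (f has_derivative blinfun_apply (f' x)) (at x)"
    and cf: "continuous_on S f'" using C1_onE[OF f] by blast
  obtain g' where dg: "\<And>x. x \<in> R \<Longrightarrow> (g has_derivative blinfun_apply (g' x)) (at x)"
    and cg: "continuous_on R g'" using C1_onE[OF g] by blast
  show ?thesis
  proof (rule C1_onI)
    show "((\<lambda>x. g (f x)) has_derivative blinfun_apply (g' (f x) o\<^sub>L f' x)) (at x)" if "x \<in> S" for x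
      using diff_chain_at[OF df dg] that assms(3)
      by (force simp: blinfun_compose.rep_eq o_def)
    have "continuous_on S (\<lambda>x. g' (f x))"
      using continuous_on_compose2[OF cg C1_on_imp_continuous_on[OF f]] assms(3) .
    then show "continuous_on S (\<lambda>x. g' (f x) o\<^sub>L f' x)"
      by (intro continuous_intros cf cg)
  qed
qed

section \<open>The same closure properties one order higher\<close>

lemma C2_on_compose:
  assumes g: "C2_on R g" and f: "C2_on S f" and "f ` S \<subseteq> R"
  shows "C2_on S (\<lambda>x. g (f x))"
proof -
  obtain f' where df: "\<And>x. x \<in> S \<Longrightarrow> (f has_derivative blinfun_apply (f' x)) (at x)"
    and cf: "C1_on S f'" using C2_onE[OF f] by blast
  obtain g' where dg: "\<And>x. x \<in> R \<Longrightarrow> (g has_derivative blinfun_apply (g' x)) (at x)"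
    and cg: "C1_on R g'" using C2_onE[OF g] by blast
  show ?thesis
  proof (rule C2_onI)
    show "((\<lambda>x. g (f x)) has_derivative blinfun_apply (g' (f x) o\<^sub>L f' x)) (at x)" if "x \<in> S" for x
      using diff_chain_at[OF df dg] that assms(3)
      by (force simp: blinfun_compose.rep_eq o_def)
    show "C1_on S (\<lambda>x. g' (f x) o\<^sub>L f' x)"
      by (intro C1_on_bilinear[OF bounded_bilinear_blinfun_compose] cf
          C1_on_compose[OF cg C2_on_imp_C1_on[OF f]] assms(3))
  qed
qed

lemma C2_on_linear:
  assumes L: "bounded_linear L" and f: "C2_on S f"
  shows "C2_on S (\<lambda>x. L (f x))"
proof -
  from f obtain f' where d: "\<And>x. x \<in> S \<Longrightarrow> (f has_derivative blinfun_apply (f' x)) (at x)"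
    and c: "C1_on S f'" by (rule C2_onE) blast
  show ?thesis
  proof (rule C2_onI)
    show "((\<lambda>x. L (f x)) has_derivative blinfun_apply (Blinfun L o\<^sub>L f' x)) (at x)" if "x \<in> S" for x
      using bounded_linear.has_derivative[OF L d[OF that]]
      by (simp add: bounded_linear_Blinfun_apply[OF L] blinfun_compose.rep_eq o_def)
    show "C1_on S (\<lambda>x. Blinfun L o\<^sub>L f' x)"
      by (rule C1_on_linear[OF _ c]) (rule bounded_linear_intros)+
  qed
qed

lemma C2_on_add:
  assumes "C2_on S f" "C2_on S g"
  shows "C2_on S (\<lambda>x. f x + g x)"
proof -
  obtain f' where df: "\<And>x. x \<in> S \<Longrightarrow> (f has_derivative blinfun_apply (f' x)) (at x)"
    and cf: "C1_on S f'" using C2_onE[OF assms(1)] by blast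
  obtain g' where dg: "\<And>x. x \<in> S \<Longrightarrow> (g has_derivative blinfun_apply (g' x)) (at x)"
    and cg: "C1_on S g'" using C2_onE[OF assms(2)] by blast
  show ?thesis
  proof (rule C2_onI)
    show "((\<lambda>x. f x + g x) has_derivative blinfun_apply (f' x + g' x)) (at x)" if "x \<in> S" for x
      using has_derivative_add[OF df[OF that] dg[OF that]]
      by (simp add: plus_blinfun.rep_eq)
  qed (intro C1_on_add cf cg)
qed

text \<open>The derivative is the operator expression of the C1 case. Composition of operators is
  bounded bilinear, and \<open>prod_left\<close> and \<open>prod_right\<close> are bounded linear,
  so the C1 rules apply to the derivative itself.\<close>

lemma C2_on_bilinear:
  assumes B: "bounded_bilinear mul" and f: "C2_on S f" and g: "C2_on S g"
  shows "C2_on S (\<lambda>x. mul (f x) (g x))"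
proof -
  obtain f' where df: "\<And>x. x \<in> S \<Longrightarrow> (f has_derivative blinfun_apply (f' x)) (at x)"
    and cf: "C1_on S f'" using C2_onE[OF f] by blast
  obtain g' where dg: "\<And>x. x \<in> S \<Longrightarrow> (g has_derivative blinfun_apply (g' x)) (at x)"
    and cg: "C1_on S g'" using C2_onE[OF g] by blast
  let ?D = "\<lambda>x. (bounded_bilinear.prod_right mul (f x) o\<^sub>L g' x) +
    (bounded_bilinear.prod_left mul (g x) o\<^sub>L f' x)"
  show ?thesis
  proof (rule C2_onI)
    show "((\<lambda>x. mul (f x) (g x)) has_derivative blinfun_apply (?D x)) (at x)" if "x \<in> S" for x
      using bounded_bilinear.FDERIV[OF B df[OF that] dg[OF that]]
      by (simp add: plus_blinfun.rep_eq blinfun_compose.rep_eq bounded_bilinear.prod_right.rep_eq[OF B]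
          bounded_bilinear.prod_left.rep_eq[OF B] o_def)
    show "C1_on S ?D"
      by (intro C1_on_add C1_on_bilinear[OF bounded_bilinear_blinfun_compose] cf cg
          C1_on_linear[OF bounded_bilinear.bounded_linear_prod_right[OF B]]
          C1_on_linear[OF bounded_bilinear.bounded_linear_prod_left[OF B]]
          C2_on_imp_C1_on f g)
  qed
qed

lemma C2_on_ident: "C2_on S (\<lambda>x. x)"
proof (rule C2_onI)
  show "((\<lambda>x. x) has_derivative blinfun_apply id_blinfun) (at x)" for x :: 'a
    by (simp add: id_blinfun.rep_eq has_derivative_ident)
  show "C1_on S (\<lambda>x. id_blinfun :: 'a \<Rightarrow>\<^sub>L 'a)"
    by (rule C1_onI[of _ _ "\<lambda>_. 0"]) (simp_all add: zero_blinfun.rep_eq)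
qed

section \<open>Symmetry of the second derivative\<close>

text \<open>Mean value inequality along the parallel segments \<open>x + u + t v\<close> and
  \<open>x + t v\<close>. The difference of \<open>f\<close> along them has derivative
  \<open>(f' (x + u + t v) - f' (x + t v)) v\<close> in \<open>t\<close>, and hypothesis
  \<open>e\<close> compares this with \<open>f'' u v\<close>.\<close>

lemma second_difference_bound:
  fixes f :: "'a::real_normed_vector \<Rightarrow> 'b::real_normed_vector"
  assumes f: "\<And>y. norm (y - x) < d \<Longrightarrow> (f has_derivative blinfun_apply (f' y)) (at y)"
    and f'': "linear f''"
    and e: "\<And>y. norm (y - x) < d \<Longrightarrow> norm (f' y - f' x - f'' (y - x)) \<le> e * norm (y - x)"
    and d: "norm u + norm v < d" and "e \<ge> 0"
  shows "norm (f (x + u + v) - f (x + u) - f (x + v) + f x - blinfun_apply (f'' u) v)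
    \<le> 2 * e * (norm u + norm v)\<^sup>2"
proof -
  \<comment> \<open>The linear term is subtracted in advance, so that \<open>k 1 - k 0\<close> is
    exactly the quantity to be bounded.\<close>
  define k where "k t = f (x + u + t *\<^sub>R v) - f (x + t *\<^sub>R v) - t *\<^sub>R blinfun_apply (f'' u) v" for t :: real
  define k' where "k' t = blinfun_apply (f' (x + u + t *\<^sub>R v) - f' (x + t *\<^sub>R v) - f'' u) v" for t
  have tv: "norm (t *\<^sub>R v) \<le> norm v" if "t \<in> {0..1}" for t
    using that by (simp add: mult_left_le_one_le)
  have n1: "norm (u + t *\<^sub>R v) \<le> norm u + norm v" if "t \<in> {0..1}" for t
    using tv[OF that] norm_triangle_ineq[of u "t *\<^sub>R v"] by linarith
  have n2: "norm (t *\<^sub>R v) \<le> norm u + norm v" if "t \<in> {0..1}" for t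
    using tv[OF that] norm_ge_zero[of u] by linarith
  have "norm (k 1 - k 0) \<le> (2 * e * (norm u + norm v) * norm v) * norm (1 - 0 :: real)"
  proof (rule differentiable_bound[of "{0..1}" k "\<lambda>t s. s *\<^sub>R k' t"])
    fix t :: real assume t: "t \<in> {0..1}"
    have a: "((\<lambda>t. x + u + t *\<^sub>R v) has_derivative (\<lambda>s. s *\<^sub>R v)) (at t within {0..1})"
      "((\<lambda>t. x + t *\<^sub>R v) has_derivative (\<lambda>s. s *\<^sub>R v)) (at t within {0..1})"
      by (auto intro!: derivative_eq_intros)
    have b: "(f has_derivative blinfun_apply (f' (x + u + t *\<^sub>R v))) (at (x + u + t *\<^sub>R v))"
      "(f has_derivative blinfun_apply (f' (x + t *\<^sub>R v))) (at (x + t *\<^sub>R v))"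
      using n1[OF t] n2[OF t] d by (auto intro!: f simp: add.assoc)
    show "(k has_derivative (\<lambda>s. s *\<^sub>R k' t)) (at t within {0..1})"
      unfolding k_def k'_def
      by (rule derivative_eq_intros has_derivative_compose[OF a(1) b(1)]
          has_derivative_compose[OF a(2) b(2)] refl)+
        (simp add: blinfun.diff_left blinfun.scaleR_right scaleR_diff_right)
    \<comment> \<open>Insert the linear approximation of \<open>f'\<close> at \<open>x\<close> at
      both points; the linear parts combine by
      \<open>f'' (u + t v) - f'' (t v) = f'' u\<close>.\<close>
    have "f' (x + u + t *\<^sub>R v) - f' (x + t *\<^sub>R v) - f'' u =
      (f' (x + u + t *\<^sub>R v) - f' x - f'' (x + u + t *\<^sub>R v - x)) - (f' (x + t *\<^sub>R v) - f' x - f'' (x + t *\<^sub>R v - x))"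
      by (simp add: linear_add[OF f''] add.assoc)
    also have "norm \<dots> \<le> e * norm (x + u + t *\<^sub>R v - x) + e * norm (x + t *\<^sub>R v - x)"
      using n1[OF t] n2[OF t] d
      by (intro order_trans[OF norm_triangle_ineq4] add_mono e) (auto simp: add.assoc)
    also have "\<dots> \<le> e * (norm u + norm v) + e * (norm u + norm v)"
      using n1[OF t] n2[OF t] \<open>e \<ge> 0\<close> by (intro add_mono mult_left_mono) (auto simp: add.assoc)
    finally have *: "norm (f' (x + u + t *\<^sub>R v) - f' (x + t *\<^sub>R v) - f'' u) \<le> 2 * e * (norm u + norm v)"
      by simp
    have "norm (k' t) \<le> 2 * e * (norm u + norm v) * norm v"
      unfolding k'_def by (rule order_trans[OF norm_blinfun mult_right_mono[OF *]]) simp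
    then show "onorm (\<lambda>s. s *\<^sub>R k' t) \<le> 2 * e * (norm u + norm v) * norm v"
      by (intro onorm_le) (simp add: mult.commute[of _ "\<bar>_\<bar>"] mult_left_mono)
  qed auto
  also have "\<dots> \<le> (2 * e * (norm u + norm v)) * (norm u + norm v)"
    using \<open>e \<ge> 0\<close> by (simp add: mult_left_mono)
  finally show ?thesis
    by (simp add: k_def power2_eq_square algebra_simps)
qed

text \<open>The second difference of \<open>f\<close> is symmetric in the two increments, so
  \<open>f'' u v\<close> and \<open>f'' v u\<close> approximate the same quantity. For increments
  \<open>s u\<close> and \<open>s v\<close> the error is of order \<open>e s^2\<close>; dividing by
  \<open>s^2\<close> leaves a multiple of the arbitrary \<open>e\<close>.\<close>

lemma second_derivative_symmetric:
  fixes f :: "'a::real_normed_vector \<Rightarrow> 'b::real_normed_vector"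
  assumes "open S" "x \<in> S"
    and f: "\<And>y. y \<in> S \<Longrightarrow> (f has_derivative blinfun_apply (f' y)) (at y)"
    and f': "(f' has_derivative f'') (at x)"
  shows "blinfun_apply (f'' u) v = blinfun_apply (f'' v) u"
proof -
  define N where "N = norm u + norm v"
  have lin: "linear f''" using f' has_derivative_linear by blast
  have bd: "norm (blinfun_apply (f'' u) v - blinfun_apply (f'' v) u) \<le> e * (4 * N\<^sup>2)" if "e > 0" for e
  proof -
    obtain d1 where d1: "d1 > 0" "\<And>y. norm (y - x) < d1 \<Longrightarrow> norm (f' y - f' x - f'' (y - x)) \<le> e * norm (y - x)"
      using f' \<open>e > 0\<close> unfolding has_derivative_at_alt by blast
    obtain d2 where d2: "d2 > 0" "ball x d2 \<subseteq> S" using assms(1,2) openE by blast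
    define d where "d = min d1 d2"
    have "d > 0" using d1 d2 by (simp add: d_def)
    \<comment> \<open>Scales the increments so that their total length \<open>s * N\<close> is below
      \<open>d\<close>; the \<open>+ 1\<close> keeps the denominator positive when both vectors
      vanish.\<close>
    define s where "s = d / (2 * (N + 1))"
    have "N \<ge> 0" by (simp add: N_def)
    then have "s > 0" using \<open>d > 0\<close> by (simp add: s_def)
    have "s * N < d" using \<open>N \<ge> 0\<close> \<open>d > 0\<close> by (simp add: s_def field_simps add_strict_increasing)
    then have sn: "norm (s *\<^sub>R u) + norm (s *\<^sub>R v) < d" "norm (s *\<^sub>R v) + norm (s *\<^sub>R u) < d"
      using \<open>s > 0\<close> by (simp_all add: N_def algebra_simps)
    have fd: "(f has_derivative blinfun_apply (f' y)) (at y)" if "norm (y - x) < d" for y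
      using that d2(2) by (intro f) (auto simp: d_def dist_norm norm_minus_commute)
    have ed: "norm (f' y - f' x - f'' (y - x)) \<le> e * norm (y - x)" if "norm (y - x) < d" for y
      using that d1(2) by (simp add: d_def)
    let ?\<Delta> = "f (x + s *\<^sub>R u + s *\<^sub>R v) - f (x + s *\<^sub>R u) - f (x + s *\<^sub>R v) + f x"
    have sN: "norm (s *\<^sub>R u) + norm (s *\<^sub>R v) = s * N" "norm (s *\<^sub>R v) + norm (s *\<^sub>R u) = s * N"
      using \<open>s > 0\<close> by (simp_all add: N_def algebra_simps)
    have eq: "f'' (s *\<^sub>R w) (s *\<^sub>R z) = s\<^sup>2 *\<^sub>R f'' w z" for w z
      by (simp add: linear_scale[OF lin] blinfun.scaleR_left blinfun.scaleR_right power2_eq_square)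
    have "e \<ge> 0" using \<open>e > 0\<close> by simp
    have A: "norm (?\<Delta> - s\<^sup>2 *\<^sub>R f'' u v) \<le> 2 * e * (s * N)\<^sup>2"
      using second_difference_bound[OF fd lin ed sn(1) \<open>e \<ge> 0\<close>] unfolding eq sN by blast
    have "f (x + s *\<^sub>R v + s *\<^sub>R u) - f (x + s *\<^sub>R v) - f (x + s *\<^sub>R u) + f x = ?\<Delta>"
      by (simp add: add.assoc add.commute[of "s *\<^sub>R u"])
    then have B: "norm (?\<Delta> - s\<^sup>2 *\<^sub>R f'' v u) \<le> 2 * e * (s * N)\<^sup>2"
      using second_difference_bound[OF fd lin ed sn(2) \<open>e \<ge> 0\<close>] unfolding eq sN by metis
    have "norm (s\<^sup>2 *\<^sub>R (f'' u v - f'' v u)) \<le> 2 * (2 * e * (s * N)\<^sup>2)"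
      using norm_triangle_ineq4[of "?\<Delta> - s\<^sup>2 *\<^sub>R f'' v u" "?\<Delta> - s\<^sup>2 *\<^sub>R f'' u v"] A B
      by (simp add: scaleR_diff_right)
    then have "s\<^sup>2 * norm (f'' u v - f'' v u) \<le> s\<^sup>2 * (e * (4 * N\<^sup>2))"
      by (simp only: norm_scaleR power_mult_distrib) (simp add: algebra_simps)
    then show ?thesis using \<open>s > 0\<close> by simp
  qed
  have "norm (f'' u v - f'' v u) \<le> 0"
  proof (rule field_le_epsilon)
    fix e :: real assume "e > 0"
    define K where "K = 4 * N\<^sup>2 + 1"
    have "K > 0" by (simp add: K_def add_nonneg_pos)
    have "norm (f'' u v - f'' v u) \<le> (e / K) * (4 * N\<^sup>2)"
      using \<open>e > 0\<close> \<open>K > 0\<close> by (intro bd) simp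
    also have "\<dots> \<le> (e / K) * K"
      using \<open>e > 0\<close> \<open>K > 0\<close> by (intro mult_left_mono) (simp_all add: K_def)
    also have "\<dots> = e" using \<open>K > 0\<close> by simp
    finally show "norm (f'' u v - f'' v u) \<le> 0 + e" by simp
  qed
  then show ?thesis by simp
qed

section \<open>Poincare lemma on a ball and local injectivity of immersions\<close>

text \<open>The primitive is the integral of \<omega> along the segment from the centre,
  differentiated under the integral sign. The free value \<open>c\<close> at the centre later fixes
  the height of the graph over the given point.\<close>

lemma closed_one_form_exact_on_ball:
  fixes \<omega> :: "'a::euclidean_space \<Rightarrow> 'a \<Rightarrow>\<^sub>L real"
  assumes d\<omega>: "\<And>x. x \<in> ball a r \<Longrightarrow> (\<omega> has_derivative blinfun_apply (\<omega>' x)) (at x)"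
    and c\<omega>': "continuous_on (ball a r) \<omega>'"
    and closed: "\<And>x u v. x \<in> ball a r \<Longrightarrow> blinfun_apply (\<omega>' x u) v = blinfun_apply (\<omega>' x v) u"
    and "r > 0"
  obtains f where "\<And>x. x \<in> ball a r \<Longrightarrow> (f has_derivative blinfun_apply (\<omega> x)) (at x)" "f a = c"
proof -
  define p where "p x t = a + t *\<^sub>R (x - a)" for x :: 'a and t :: real
  define g where "g x t = blinfun_apply (\<omega> (p x t)) (x - a)" for x t
  \<comment> \<open>Differentiating \<open>g x t\<close> in \<open>x\<close> along \<open>v\<close>
    gives \<open>t \<omega>' (p x t) v (x - a) + \<omega> (p x t) v\<close>; the definition has the
    arguments \<open>v\<close> and \<open>x - a\<close> already exchanged, as closedness
    permits.\<close>
  define g' where "g' x t = t *\<^sub>R \<omega>' (p x t) (x - a) + \<omega> (p x t)" for x t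
  define f where "f x = c + integral (cbox 0 1) (g x)" for x
  have p: "p x t \<in> ball a r" if "x \<in> ball a r" "t \<in> cbox 0 1" for x t
  proof -
    have "norm (t *\<^sub>R (x - a)) \<le> norm (x - a)" using that by (simp add: mult_left_le_one_le)
    then show ?thesis using that by (simp add: p_def dist_norm norm_minus_commute)
  qed
  have c\<omega>: "continuous_on (ball a r) \<omega>"
    by (intro continuous_at_imp_continuous_on ballI has_derivative_continuous[OF d\<omega>])
  have cp: "continuous_on (ball a r \<times> cbox 0 1) (\<lambda>z. p (fst z) (snd z))"
    unfolding p_def by (intro continuous_intros)
  have pim: "(\<lambda>z. p (fst z) (snd z)) ` (ball a r \<times> cbox 0 1) \<subseteq> ball a r"
    using p by fastforce
  have c1: "continuous_on (ball a r \<times> cbox 0 1) (\<lambda>z. \<omega> (p (fst z) (snd z)))"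
    by (rule continuous_on_compose2[OF c\<omega> cp pim])
  have c2: "continuous_on (ball a r \<times> cbox 0 1) (\<lambda>z. \<omega>' (p (fst z) (snd z)))"
    by (rule continuous_on_compose2[OF c\<omega>' cp pim])
  have cg': "continuous_on (ball a r \<times> cbox 0 1) (\<lambda>(x, t). g' x t)"
    unfolding g'_def split_beta by (intro continuous_intros c1 c2)
  have dg: "((\<lambda>x. g x t) has_derivative blinfun_apply (g' x t)) (at x within ball a r)"
    if "x \<in> ball a r" "t \<in> cbox 0 1" for x t
  proof -
    have dp: "((\<lambda>x. p x t) has_derivative (\<lambda>v. t *\<^sub>R v)) (at x within ball a r)"
      unfolding p_def by (auto intro!: derivative_eq_intros)
    have "((\<lambda>x. \<omega> (p x t)) has_derivative (\<lambda>v. blinfun_apply (\<omega>' (p x t)) (t *\<^sub>R v))) (at x within ball a r)"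
      using has_derivative_compose[OF dp d\<omega>[OF p[OF that]]] .
    from blinfun.FDERIV[OF this has_derivative_diff[OF has_derivative_ident has_derivative_const[of a]]]
    show ?thesis unfolding g_def
      by (rule has_derivative_eq_rhs)
        (auto simp: g'_def fun_eq_iff blinfun.add_left blinfun.scaleR_left blinfun.scaleR_right
          closed[OF p[OF that]])
  qed
  have ig: "g x integrable_on cbox 0 1" if "x \<in> ball a r" for x
    unfolding g_def
    by (intro integrable_continuous continuous_intros continuous_on_compose2[OF c\<omega>, of _ "p x"])
      (use p that in \<open>auto simp: p_def intro!: continuous_intros\<close>)
  \<comment> \<open>Closedness makes \<open>g' x t\<close>, the derivative of \<open>g\<close> in \<open>x\<close>, also the \<open>t\<close>-derivative of \<open>t \<omega> (p x t)\<close>.\<close>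
  have G: "integral (cbox 0 1) (g' x) = \<omega> x" if x: "x \<in> ball a r" for x
  proof -
    have "((\<lambda>t. t *\<^sub>R \<omega> (p x t)) has_vector_derivative g' x t) (at t within {0..1})"
      if t: "t \<in> {0..1}" for t
    proof -
      have dp: "((\<lambda>t. p x t) has_derivative (\<lambda>s. s *\<^sub>R (x - a))) (at t within {0..1})"
        unfolding p_def by (auto intro!: derivative_eq_intros)
      have "((\<lambda>t. \<omega> (p x t)) has_derivative (\<lambda>s. blinfun_apply (\<omega>' (p x t)) (s *\<^sub>R (x - a)))) (at t within {0..1})"
        using has_derivative_compose[OF dp d\<omega>[OF p[OF x]]] t by simp
      from has_derivative_scaleR[OF has_derivative_ident this]
      show ?thesis unfolding has_vector_derivative_def
        by (rule has_derivative_eq_rhs)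
          (simp add: g'_def fun_eq_iff blinfun.scaleR_right scaleR_add_right mult.commute add.commute)
    qed
    from fundamental_theorem_of_calculus[OF _ this]
    have "(g' x has_integral \<omega> (p x 1)) {0..1}" by simp
    then show ?thesis by (simp add: p_def integral_unique)
  qed
  show ?thesis
  proof (rule that)
    fix x assume x: "x \<in> ball a r"
    have "((\<lambda>x. integral (cbox 0 1) (g x)) has_derivative integral (cbox 0 1) (g' x)) (at x within ball a r)"
      using leibniz_rule[OF dg ig cg' x] by simp
    then show "(f has_derivative blinfun_apply (\<omega> x)) (at x)"
      using x unfolding f_def G[OF x] by (auto intro!: derivative_eq_intros simp: at_within_open[OF x])
  next
    show "f a = c" by (simp add: f_def g_def[abs_def])
  qed
qed

text \<open>An injective linear map in finite dimension is bounded below, here by \<open>b\<close>.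
  On a ball where \<open>G'\<close> stays within \<open>b / 2\<close> of \<open>G' x0\<close>, half
  of the bound survives for \<open>G' x\<close> and, by the mean value inequality, for differences
  of \<open>G\<close>. The first estimate keeps \<open>G\<close> an immersion on the ball, the
  second makes it an embedding.\<close>

lemma immersion_locally_bounded_below:
  fixes G :: "'m::euclidean_space \<Rightarrow> 'b::euclidean_space"
  assumes "open S" "x0 \<in> S"
    and G: "\<And>x. x \<in> S \<Longrightarrow> (G has_derivative blinfun_apply (G' x)) (at x)"
    and cG': "continuous_on S G'" and inj: "inj (blinfun_apply (G' x0))"
  obtains c e where "c > 0" "e > 0" "ball x0 e \<subseteq> S"
    "\<And>x v. x \<in> ball x0 e \<Longrightarrow> c * norm v \<le> norm (blinfun_apply (G' x) v)"
    "\<And>x y. x \<in> ball x0 e \<Longrightarrow> y \<in> ball x0 e \<Longrightarrow> c * norm (x - y) \<le> norm (G x - G y)"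
proof -
  obtain b where b: "b > 0" "\<And>v. b * norm v \<le> norm (blinfun_apply (G' x0) v)"
    using linear_inj_bounded_below_pos[OF bounded_linear.linear[OF blinfun.bounded_linear_right] inj] by blast
  obtain e1 where e1: "e1 > 0" "\<And>x. x \<in> S \<Longrightarrow> dist x x0 < e1 \<Longrightarrow> dist (G' x) (G' x0) < b / 2"
    using cG' \<open>x0 \<in> S\<close> b(1) unfolding continuous_on_iff by (meson half_gt_zero)
  obtain e2 where e2: "e2 > 0" "ball x0 e2 \<subseteq> S" using assms(1,2) openE by blast
  define e where "e = min e1 e2"
  have S: "ball x0 e \<subseteq> S" using e2 by (auto simp: e_def)
  have n: "norm (G' x - G' x0) \<le> b / 2" if "x \<in> ball x0 e" for x
    using e1(2)[of x] that S by (auto simp: e_def dist_norm norm_minus_commute)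
  show ?thesis
  proof
    show "b / 2 > 0" "e > 0" "ball x0 e \<subseteq> S" using b e1 e2 S by (auto simp: e_def)
    fix x v assume x: "x \<in> ball x0 e"
    have "norm (blinfun_apply (G' x - G' x0) v) \<le> b / 2 * norm v"
      by (rule order_trans[OF norm_blinfun mult_right_mono[OF n[OF x]]]) simp
    moreover have "norm (G' x0 v) \<le> norm (G' x v) + norm (blinfun_apply (G' x - G' x0) v)"
      using norm_triangle_ineq4[of "G' x v" "blinfun_apply (G' x - G' x0) v"] by (simp add: blinfun.diff_left)
    ultimately show "b / 2 * norm v \<le> norm (G' x v)" using b(2)[of v] by linarith
  next
    fix x y assume x: "x \<in> ball x0 e" and y: "y \<in> ball x0 e"
    have "norm (G x - G y - G' x0 (x - y)) \<le> norm (x - y) * (b / 2)"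
    proof (rule differentiable_bound_linearization[where S = "ball x0 e" and f' = "\<lambda>x. blinfun_apply (G' x)"])
      show "y + t *\<^sub>R (x - y) \<in> ball x0 e" if "t \<in> {0..1}" for t
        using convexD_alt[OF convex_ball y x, of t] that by (simp add: algebra_simps)
      show "(G has_derivative blinfun_apply (G' z)) (at z within ball x0 e)" if "z \<in> ball x0 e" for z
        using G S that by (meson has_derivative_at_withinI subsetD)
      show "onorm (blinfun_apply (G' z) - blinfun_apply (G' x0)) \<le> b / 2" if "z \<in> ball x0 e" for z
        using n[OF that] by (simp add: norm_blinfun.rep_eq minus_blinfun.rep_eq fun_diff_def)
      show "x0 \<in> ball x0 e" using x by (auto intro: le_less_trans[OF zero_le_dist])
    qed
    moreover have "norm (G' x0 (x - y)) \<le> norm (G x - G y) + norm (G x - G y - G' x0 (x - y))"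
      using norm_triangle_ineq4[of "G x - G y" "G x - G y - G' x0 (x - y)"] by simp
    ultimately show "b / 2 * norm (x - y) \<le> norm (G x - G y)" using b(2)[of "x - y"] by (simp add: mult.commute)
  qed
qed

section \<open>Charts\<close>

lemma second_countable_euclidean: "second_countable (euclidean :: 'a::euclidean_space topology)"
proof -
  obtain \<B> :: "'a set set" where "countable \<B>" "\<And>C. C \<in> \<B> \<Longrightarrow> open C"
    "\<And>S. open S \<Longrightarrow> \<exists>U. U \<subseteq> \<B> \<and> S = \<Union>U"
    using univ_second_countable by blast
  then show ?thesis
    unfolding second_countable_def open_openin[symmetric]
    by (intro exI[of _ \<B>]) (metis Union_iff Union_upper subsetD)
qed

lemma C2_manifold_chart:
  assumes "C2_manifold T A" "(U, \<phi>) \<in> A"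
  shows chart_domain_open: "openin T U"
    and chart_range_open: "open (\<phi> ` U)"
    and chart_homeomorphic_map: "homeomorphic_map (subtopology T U) (top_of_set (\<phi> ` U)) \<phi>"
    and chart_inj: "inj_on \<phi> U"
proof -
  show U: "openin T U" and "open (\<phi> ` U)"
    and h: "homeomorphic_map (subtopology T U) (top_of_set (\<phi> ` U)) \<phi>"
    using assms unfolding C2_manifold_def by blast+
  show "inj_on \<phi> U"
    using homeomorphic_imp_injective_map[OF h] openin_subset[OF U]
    by (simp add: Int_absorb1)
qed

lemma chart_transition_C2:
  assumes "C2_manifold T A" "(U, \<phi>) \<in> A" "(V, \<psi>) \<in> A"
  shows "C2_on (\<phi> ` (U \<inter> V)) (\<psi> \<circ> inv_into U \<phi>)"
  using assms unfolding C2_manifold_def by blast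

text \<open>The topology of an immersed submanifold need not be the subspace topology, so openness
  is tested through the chart, a homeomorphism between open sets.\<close>

lemma openin_iff_chart_image_open:
  assumes "C2_manifold T A" "(U, \<phi>) \<in> A" "W \<subseteq> U"
  shows "openin T W \<longleftrightarrow> open (\<phi> ` W)"
proof -
  note ch = C2_manifold_chart[OF assms(1,2)]
  have "openin T W \<longleftrightarrow> openin (subtopology T U) W"
    using ch(1) assms(3) openin_open_subtopology by blast
  also have "\<dots> \<longleftrightarrow> openin (top_of_set (\<phi> ` U)) (\<phi> ` W)"
    using homeomorphic_map_openness[OF ch(3)] assms(3) openin_subset[OF ch(1)] by (simp add: Int_absorb1)
  also have "\<dots> \<longleftrightarrow> open (\<phi> ` W)"
    using ch(2) assms(3) by (auto simp: openin_open_eq)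
  finally show ?thesis .
qed

text \<open>Smoothness is demanded in every chart of the atlas, but \<open>f\<close> lives in one;
  composing with the C2 transition maps reaches the others.\<close>

lemma smooth_on_chart_compose:
  assumes M: "C2_manifold T A" and U: "(U, \<phi>) \<in> A" and W: "W \<subseteq> U" and f: "C2_on (\<phi> ` W) f"
  shows "smooth_on A W (f \<circ> \<phi>)"
  unfolding smooth_on_def
proof (clarify)
  fix V \<psi> assume V: "(V, \<psi>) \<in> A"
  note inj = chart_inj[OF M V]
  have "C2_on (\<psi> ` (V \<inter> W)) (\<lambda>x. f ((\<phi> \<circ> inv_into V \<psi>) x))"
  proof (rule C2_on_compose[OF f])
    show "C2_on (\<psi> ` (V \<inter> W)) (\<phi> \<circ> inv_into V \<psi>)"
      using W by (intro C2_on_subset[OF chart_transition_C2[OF M V U]]) auto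
    show "(\<phi> \<circ> inv_into V \<psi>) ` \<psi> ` (V \<inter> W) \<subseteq> \<phi> ` W"
      using inj by auto
  qed
  then show "C2_on (\<psi> ` (V \<inter> W)) (f \<circ> \<phi> \<circ> inv_into V \<psi>)"
    by (simp add: o_def)
qed

text \<open>Chain rule for \<open>f\<close> read in the second chart, which factors through the
  transition map near \<open>\<psi> q\<close>, on the open image of the overlap.\<close>

lemma differential_change_chart:
  assumes M: "C2_manifold T A" and U: "(U, \<phi>) \<in> A" and V: "(V, \<psi>) \<in> A" and q: "q \<in> U" "q \<in> V"
    and f: "(f \<circ> inv_into U \<phi>) differentiable at (\<phi> q)"
  shows "differential V \<psi> f q =
    differential U \<phi> f q \<circ> frechet_derivative (\<phi> \<circ> inv_into V \<psi>) (at (\<psi> q))"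
proof -
  let ?\<tau> = "\<phi> \<circ> inv_into V \<psi>"
  note inj = chart_inj[OF M U] chart_inj[OF M V]
  have \<tau>q: "?\<tau> (\<psi> q) = \<phi> q" using inj q by simp
  have o: "open (\<psi> ` (V \<inter> U))"
    using openin_iff_chart_image_open[OF M V, of "V \<inter> U"] chart_domain_open[OF M U]
      chart_domain_open[OF M V] by auto
  have "?\<tau> differentiable at (\<psi> q)"
    using chart_transition_C2[OF M V U] q by (auto elim!: C2_onE simp: differentiable_def)
  then have D: "((f \<circ> inv_into U \<phi> \<circ> ?\<tau>) has_derivative
      differential U \<phi> f q \<circ> frechet_derivative ?\<tau> (at (\<psi> q))) (at (\<psi> q))"
    using f unfolding differential_def frechet_derivative_works[of _ "at _"]
    by (intro diff_chain_at) (auto simp: \<tau>q[simplified])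
  have "((f \<circ> inv_into V \<psi>) has_derivative
      differential U \<phi> f q \<circ> frechet_derivative ?\<tau> (at (\<psi> q))) (at (\<psi> q))"
    by (rule has_derivative_transform_within_open[OF D o]) (use q inj in auto)
  then show ?thesis
    by (simp only: differential_def[of V] frechet_derivative_at[symmetric])
qed

text \<open>Passing to another chart precomposes both differentials with the derivative of the same
  transition map, so \<open>eq\<close> at the transformed vector gives the claim there.\<close>

lemma is_differential_on_chart:
  assumes M: "C2_manifold T A" and U: "(U, \<phi>) \<in> A" and W: "W \<subseteq> U"
    and id: "\<And>q. q \<in> W \<Longrightarrow> inv_into U \<phi> differentiable at (\<phi> q)"
    and F: "\<And>q. q \<in> W \<Longrightarrow> (F \<circ> inv_into U \<phi>) differentiable at (\<phi> q)"
    and eq: "\<And>q v. q \<in> W \<Longrightarrow> \<omega> q (differential U \<phi> (\<lambda>q. q) q v) = differential U \<phi> F q v"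
  shows "is_differential_on A W F \<omega>"
  unfolding is_differential_on_def
proof clarify
  fix V \<psi> q v assume V: "(V, \<psi>) \<in> A" and q: "q \<in> V" "q \<in> W"
  have "q \<in> U" using q W by blast
  have "((\<lambda>q. q) \<circ> inv_into U \<phi>) differentiable at (\<phi> q)"
    using id[OF q(2)] by (simp add: o_def)
  then show "\<omega> q (differential V \<psi> (\<lambda>q. q) q v) = differential V \<psi> F q v"
    by (simp add: differential_change_chart[OF M U V \<open>q \<in> U\<close> q(1)] F q(2) eq)
qed

section \<open>Submanifolds parametrized by one homeomorphism\<close>

lemma homeomorphism_inv_into_image:
  assumes "homeomorphism R N G k" "x \<in> R"
  shows "inv_into N k x = G x"
proof (rule inv_into_f_eq)
  show "inj_on k N"
    by (rule inj_on_inverseI[of _ G]) (use assms in \<open>auto simp: homeomorphism_def\<close>)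
qed (use assms in \<open>auto simp: homeomorphism_def\<close>)

lemma differential_single_chart:
  assumes k: "homeomorphism R N G k" and "open R" "x \<in> R"
    and G: "((\<lambda>x. f (G x)) has_derivative D) (at x)"
  shows "differential N k f (G x) = D"
proof -
  have "k (G x) = x" using k \<open>x \<in> R\<close> by (auto simp: homeomorphism_def)
  have "((f \<circ> inv_into N k) has_derivative D) (at x)"
    by (rule has_derivative_transform_within_open[OF G \<open>open R\<close> \<open>x \<in> R\<close>])
      (simp add: homeomorphism_inv_into_image[OF k])
  then show ?thesis
    unfolding differential_def \<open>k (G x) = x\<close> by (rule frechet_derivative_at[symmetric])
qed

text \<open>The chart \<open>k\<close> is the inverse of the parametrization, so the inverse chart
  is \<open>G\<close> again: the only transition map is the identity, and the conditions on the
  inclusion become conditions on \<open>G\<close>. The subspace topology is right because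
  \<open>G\<close> is a homeomorphism onto \<open>N\<close>.\<close>

lemma immersed_submanifold_single_chart:
  fixes G :: "'m::euclidean_space \<Rightarrow> 'b::euclidean_space"
  assumes k: "homeomorphism R N G k" and "open R" and C2: "C2_on R G"
    and G: "\<And>x. x \<in> R \<Longrightarrow> (G has_derivative G' x) (at x)" and inj: "\<And>x. x \<in> R \<Longrightarrow> inj (G' x)"
  shows "immersed_submanifold N (top_of_set N) {(N, k)}"
proof -
  have im: "k ` N = R" "G ` R = N" using k by (auto simp: homeomorphism_def)
  have hm: "homeomorphic_map (top_of_set N) (top_of_set R) k"
    using k by (auto simp: homeomorphic_map_maps homeomorphic_maps_def homeomorphism_def)
  have kG: "k (G x) = x" if "x \<in> R" for x using k that by (auto simp: homeomorphism_def)
  have "C2_on R (k \<circ> inv_into N k)"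
    by (rule C2_on_cong[OF C2_on_ident \<open>open R\<close>]) (simp add: homeomorphism_inv_into_image[OF k] kG)
  then have "C2_manifold (top_of_set N) {(N, k)}"
    using hm \<open>open R\<close> second_countable_subtopology[OF second_countable_euclidean]
    by (simp add: C2_manifold_def im Hausdorff_space_subtopology subtopology_subtopology)
  moreover have "C2_on R ((\<lambda>q. q) \<circ> inv_into N k)"
    by (rule C2_on_cong[OF C2 \<open>open R\<close>]) (simp add: homeomorphism_inv_into_image[OF k])
  moreover have "inj (differential N k (\<lambda>q. q) q)" if "q \<in> N" for q
    using that im(2) differential_single_chart[OF k \<open>open R\<close> _ G] inj by force
  ultimately show ?thesis
    by (simp add: immersed_submanifold_def smooth_on_def immersion_at_def im)
qed

text \<open>The lower bound makes \<open>G\<close> injective and its inverse Lipschitz with constant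
  \<open>1 / c\<close>.\<close>

lemma expanding_homeomorphism:
  assumes "continuous_on R G" "c > 0"
    and "\<And>x y. x \<in> R \<Longrightarrow> y \<in> R \<Longrightarrow> c * norm (x - y) \<le> norm (G x - G y)"
  shows "homeomorphism R (G ` R) G (inv_into R G)"
proof -
  have inj: "inj_on G R"
    using assms(2,3) by (fastforce intro!: inj_onI simp: mult_le_0_iff)
  have "continuous_on (G ` R) (inv_into R G)"
    unfolding continuous_on_iff
  proof (intro ballI allI impI)
    fix p e assume p: "p \<in> G ` R" and "(e::real) > 0"
    have "dist (inv_into R G q) (inv_into R G p) < e" if "q \<in> G ` R" "dist q p < c * e" for q
    proof -
      have "c * norm (inv_into R G q - inv_into R G p) \<le> norm (q - p)"
        using assms(3)[OF inv_into_into[OF that(1)] inv_into_into[OF p]] that(1) p by (simp add: f_inv_into_f)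
      also have "\<dots> < c * e" using that(2) by (simp add: dist_norm)
      finally show ?thesis using \<open>c > 0\<close> by (simp add: dist_norm)
    qed
    then show "\<exists>d>0. \<forall>q\<in>G ` R. dist q p < d \<longrightarrow> dist (inv_into R G q) (inv_into R G p) < e"
      using \<open>c > 0\<close> \<open>e > 0\<close> by (intro exI[of _ "c * e"]) auto
  qed
  then show ?thesis
    using assms(1) inj by (auto simp: homeomorphism_def f_inv_into_f image_iff)
qed

section \<open>Orthogonal submanifolds\<close>

text \<open>The left side of \<open>zero\<close> is the differential of \<Psi> on the product with
  the line, read in the product chart and applied to \<open>(v, s)\<close>. The immersion hypothesis
  makes this map, called \<open>D\<close> below, injective.\<close>

lemma nonfocal_chart:
  fixes A :: "('a::euclidean_space \<times> 'a, 'm::euclidean_space) atlas"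
  assumes M: "C2_manifold T A" and U: "(U, \<phi>) \<in> A"
    and x: "x \<in> \<phi> ` U" and h: "(inv_into U \<phi> has_derivative h') (at x)"
    and imm: "immersion_at (times_line_atlas A) \<Psi> (inv_into U \<phi> x, r)"
    and zero: "snd (h' v) + s *\<^sub>R fst (inv_into U \<phi> x) + r *\<^sub>R fst (h' v) = 0"
  shows "v = 0"
proof -
  define h where "h = inv_into U \<phi>"
  note inj = chart_inj[OF M U]
  have hx: "h x \<in> U" "\<phi> (h x) = x" using x by (auto simp: h_def inv_into_into f_inv_into_f)
  have h': "(h has_derivative h') (at x)" using h by (simp add: h_def)
  define D where "D = (\<lambda>(v, s). snd (h' v) + s *\<^sub>R fst (h x) + r *\<^sub>R fst (h' v))"
  have d1: "((\<lambda>z. h (fst z)) has_derivative (\<lambda>z. h' (fst z))) (at (x, r))"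
    by (rule has_derivative_compose[OF has_derivative_fst[OF has_derivative_ident]]) (simp add: h')
  have "((\<lambda>z. snd (h (fst z)) + snd z *\<^sub>R fst (h (fst z))) has_derivative D) (at (x, r))"
    by (rule derivative_eq_intros d1 refl)+ (auto simp: D_def)
  then have "((\<Psi> \<circ> inv_into (U \<times> UNIV) (map_prod \<phi> id)) has_derivative D) (at (x, r))"
  proof (rule has_derivative_transform_within_open[of _ _ _ _ "\<phi> ` U \<times> UNIV"])
    show "open (\<phi> ` U \<times> (UNIV :: real set))"
      by (intro open_Times chart_range_open[OF M U] open_UNIV)
    show "(x, r) \<in> \<phi> ` U \<times> UNIV" using x by simp
    fix z assume z: "z \<in> \<phi> ` U \<times> (UNIV :: real set)"
    have "inv_into (U \<times> UNIV) (map_prod \<phi> id) z = (h (fst z), snd z)"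
    proof (rule inv_into_f_eq)
      show "inj_on (map_prod \<phi> id) (U \<times> UNIV)" using inj by (auto simp: inj_on_def)
    qed (use z in \<open>auto simp: h_def inv_into_into f_inv_into_f[OF imageI]\<close>)
    then show "snd (h (fst z)) + snd z *\<^sub>R fst (h (fst z)) = (\<Psi> \<circ> inv_into (U \<times> UNIV) (map_prod \<phi> id)) z"
      by (simp add: \<Psi>_def split_beta)
  qed
  then have "differential (U \<times> UNIV) (map_prod \<phi> id) \<Psi> (h x, r) = D"
    unfolding differential_def by (simp add: hx frechet_derivative_at[symmetric])
  moreover have "(U \<times> UNIV, map_prod \<phi> id) \<in> times_line_atlas A"
    using U unfolding times_line_atlas_def by force
  ultimately have "inj D"
    using imm hx unfolding immersion_at_def h_def[symmetric] by fastforce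
  moreover have "D (v, s) = D (0, 0)"
    using zero linear_0[OF has_derivative_linear[OF h']] by (simp add: D_def h_def)
  ultimately show ?thesis by (auto dest: injD)
qed

text \<open>Differentiate the constraints \<langle>\<xi>, \<xi>\<rangle> = 1 and \<langle>\<xi>,
  \<eta>\<rangle> = 0 along \<open>h\<close>. The second identity converts the \<eta>-part of a
  derivative into minus the Liouville form.\<close>

lemma TSphere_derivative:
  assumes "open D" "x \<in> D" and T: "\<And>y. y \<in> D \<Longrightarrow> h y \<in> TSphere"
    and h: "(h has_derivative h') (at x)"
  shows "fst (h x) \<bullet> fst (h' v) = 0"
    and "fst (h x) \<bullet> snd (h' v) = - (fst (h' v) \<bullet> snd (h x))"
proof -
  have T': "fst (h y) \<bullet> fst (h y) = 1" "fst (h y) \<bullet> snd (h y) = 0" if "y \<in> D" for y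
    using T[OF that] by (auto simp: TSphere_def norm_eq_1 split: prod.splits)
  have 1: "((\<lambda>y. fst (h y) \<bullet> fst (h y)) has_derivative (\<lambda>v. fst (h x) \<bullet> fst (h' v) + fst (h' v) \<bullet> fst (h x))) (at x)"
    "((\<lambda>y. fst (h y) \<bullet> snd (h y)) has_derivative (\<lambda>v. fst (h x) \<bullet> snd (h' v) + fst (h' v) \<bullet> snd (h x))) (at x)"
    by (intro has_derivative_inner has_derivative_fst has_derivative_snd h)+
  have 0: "((\<lambda>y. fst (h y) \<bullet> fst (h y)) has_derivative (\<lambda>v. 0)) (at x)"
    "((\<lambda>y. fst (h y) \<bullet> snd (h y)) has_derivative (\<lambda>v. 0)) (at x)"
    by (rule has_derivative_transform_within_open[OF has_derivative_const assms(1,2)], simp add: T')+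
  have "fst (h x) \<bullet> fst (h' v) + fst (h' v) \<bullet> fst (h x) = 0"
    "fst (h x) \<bullet> snd (h' v) + fst (h' v) \<bullet> snd (h x) = 0"
    using fun_cong[OF has_derivative_unique[OF 1(1) 0(1)], of v]
      fun_cong[OF has_derivative_unique[OF 1(2) 0(2)], of v] by simp_all
  then show "fst (h x) \<bullet> fst (h' v) = 0" "fst (h x) \<bullet> snd (h' v) = - (fst (h' v) \<bullet> snd (h x))"
    by (simp_all add: inner_commute)
qed

text \<open>In the antisymmetrized derivative of the pulled-back form the terms with second
  derivatives of \<open>h\<close> cancel by symmetry. What remains is, up to sign, the symplectic
  form on \<open>h' x u\<close> and \<open>h' x v\<close>, which vanishes by
  \<open>iso\<close>.\<close>

lemma liouville_pullback_closed:
  fixes h :: "'m::euclidean_space \<Rightarrow> 'a::euclidean_space \<times> 'a"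
  assumes "open D" and h: "\<And>x. x \<in> D \<Longrightarrow> (h has_derivative blinfun_apply (h' x)) (at x)"
    and h'C1: "C1_on D h'"
    and iso: "\<And>x u v. x \<in> D \<Longrightarrow> symplectic_form (h x) (h' x u) (h' x v) = 0"
  obtains \<omega> \<omega>' where "\<And>x v. blinfun_apply (\<omega> x) v = fst (h' x v) \<bullet> snd (h x)" "C1_on D \<omega>"
    "\<And>x. x \<in> D \<Longrightarrow> (\<omega> has_derivative blinfun_apply (\<omega>' x)) (at x)" "continuous_on D \<omega>'"
    "\<And>x u v. x \<in> D \<Longrightarrow> blinfun_apply (\<omega>' x u) v = blinfun_apply (\<omega>' x v) u"
proof -
  \<comment> \<open>Written as a composite of operators so that the C1 product rule applies.\<close>
  define \<omega> where "\<omega> x = blinfun_inner_left (snd (h x)) o\<^sub>L (fst_blinfun o\<^sub>L h' x)" for x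
  have \<omega>: "blinfun_apply (\<omega> x) v = fst (h' x v) \<bullet> snd (h x)" for x v
    by (simp add: \<omega>_def blinfun_inner_left.rep_eq)
  have "C2_on D h" using h h'C1 by (rule C2_onI)
  have C1: "C1_on D \<omega>"
    unfolding \<omega>_def
    by (intro C1_on_bilinear[OF bounded_bilinear_blinfun_compose]
        C1_on_linear[OF bounded_linear_blinfun_inner_left] C1_on_linear[OF bounded_linear_snd]
        C1_on_linear[OF bounded_bilinear.bounded_linear_right[OF bounded_bilinear_blinfun_compose]]
        C2_on_imp_C1_on[OF \<open>C2_on D h\<close>] h'C1)
  obtain \<omega>' where d\<omega>: "\<And>x. x \<in> D \<Longrightarrow> (\<omega> has_derivative blinfun_apply (\<omega>' x)) (at x)"
    and c\<omega>: "continuous_on D \<omega>'" using C1_onE[OF C1] by blast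
  obtain h'' where h'': "\<And>x. x \<in> D \<Longrightarrow> (h' has_derivative blinfun_apply (h'' x)) (at x)"
    using C1_onE[OF h'C1] by blast
  \<comment> \<open>The C1 rules give \<open>\<omega>'\<close> only abstractly; uniqueness of the
    derivative of the scalar function \<open>\<omega> x v\<close> of \<open>x\<close>, with
    \<open>v\<close> fixed, makes it explicit.\<close>
  have eq: "blinfun_apply (\<omega>' x u) v = fst (h' x v) \<bullet> snd (h' x u) + fst (blinfun_apply (h'' x u) v) \<bullet> snd (h x)"
    if "x \<in> D" for x u v
  proof -
    have 1: "((\<lambda>x. blinfun_apply (\<omega> x) v) has_derivative (\<lambda>u. blinfun_apply (\<omega>' x u) v)) (at x)"
      by (rule bounded_linear.has_derivative[OF blinfun.bounded_linear_left d\<omega>[OF that]])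
    have 2: "((\<lambda>x. fst (h' x v) \<bullet> snd (h x)) has_derivative
      (\<lambda>u. fst (h' x v) \<bullet> snd (h' x u) + fst (blinfun_apply (h'' x u) v) \<bullet> snd (h x))) (at x)"
      by (intro has_derivative_inner has_derivative_fst has_derivative_snd h[OF that]
          bounded_linear.has_derivative[OF blinfun.bounded_linear_left h''[OF that]])
    show ?thesis
      using fun_cong[OF has_derivative_unique[OF 1[unfolded \<omega>] 2], of u] .
  qed
  have closed: "blinfun_apply (\<omega>' x u) v = blinfun_apply (\<omega>' x v) u" if x: "x \<in> D" for x u v
    using iso[OF x, of u v] second_derivative_symmetric[OF \<open>open D\<close> x h h''[OF x], of u v]
    by (simp add: eq[OF x] symplectic_form_eq inner_commute)
  show thesis by (rule that[OF \<omega> C1 d\<omega> c\<omega> closed])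
qed

text \<open>The normal field is the \<xi>-component of \<open>h\<close>, and the hypothesis on the
  derivative of \<open>f\<close> makes it normal. Moreover \<open>\<Phi> \<nu> (G x) = h x\<close>:
  the map \<Phi> recovers the oriented line from its point, hence takes values in \<Gamma>.\<close>

lemma orthogonal_submanifold_parametrized:
  fixes h :: "'m::euclidean_space \<Rightarrow> 'a::euclidean_space \<times> 'a"
  assumes G_eq: "\<And>x. G x = \<Psi> (h x, f x)" and "open R" and hC2: "C2_on R h" and fC2: "C2_on R f"
    and \<Gamma>: "h ` R \<subseteq> \<Gamma>" "\<Gamma> \<subseteq> TSphere"
    and h: "\<And>x. x \<in> R \<Longrightarrow> (h has_derivative h' x) (at x)"
    and f: "\<And>x. x \<in> R \<Longrightarrow> (f has_derivative (\<lambda>v. liouville (h x) (h' x v))) (at x)"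
    and G: "\<And>x. x \<in> R \<Longrightarrow> (G has_derivative G' x) (at x)"
    and inj: "\<And>x. x \<in> R \<Longrightarrow> inj (G' x)"
    and k: "homeomorphism R N G k"
  shows "orthogonal_submanifold \<Gamma> N (top_of_set N) {(N, k)}"
proof -
  have im: "k ` N = R" "G ` R = N" using k by (auto simp: homeomorphism_def)
  have kG: "k (G x) = x" if "x \<in> R" for x using k that by (auto simp: homeomorphism_def)
  have Geq: "G = (\<lambda>x. snd (h x) + f x *\<^sub>R fst (h x))"
    by (simp add: G_eq \<Psi>_def split_beta fun_eq_iff)
  have "C2_on R G"
    unfolding Geq by (intro C2_on_add C2_on_linear[OF bounded_linear_snd] C2_on_linear[OF bounded_linear_fst]
        C2_on_bilinear[OF bounded_bilinear_scaleR] hC2 fC2)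
  then have imm: "immersed_submanifold N (top_of_set N) {(N, k)}"
    by (intro immersed_submanifold_single_chart[OF k \<open>open R\<close> _ G inj])
  define \<nu> where "\<nu> q = fst (h (k q))" for q
  have hS: "h x \<in> TSphere" if "x \<in> R" for x using \<Gamma> that by blast
  have "C2_on R (\<nu> \<circ> inv_into N k)"
    by (rule C2_on_cong[OF C2_on_linear[OF bounded_linear_fst hC2] \<open>open R\<close>])
      (simp add: \<nu>_def homeomorphism_inv_into_image[OF k] kG)
  then have "smooth_on {(N, k)} N \<nu>" by (simp add: smooth_on_def im)
  moreover have "norm (\<nu> q) = 1 \<and> (\<forall>X\<in>tangent_space {(N, k)} q. \<nu> q \<bullet> X = 0) \<and> \<Phi> \<nu> q \<in> \<Gamma>"
    if q: "q \<in> N" for q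
  proof -
    from q[folded im(2)] obtain x where x: "x \<in> R" "q = G x" by blast
    obtain \<xi> \<eta> where hx: "h x = (\<xi>, \<eta>)" by (cases "h x")
    have \<xi>: "\<xi> \<bullet> \<xi> = 1" "\<xi> \<bullet> \<eta> = 0" "norm \<xi> = 1"
      using hS[OF x(1)] by (auto simp: hx TSphere_def norm_eq_1)
    have \<nu>q: "\<nu> q = \<xi>" by (simp add: \<nu>_def x kG hx)
    note T = TSphere_derivative[OF \<open>open R\<close> x(1) hS h[OF x(1)], unfolded hx fst_conv snd_conv]
    have "(G has_derivative (\<lambda>v. snd (h' x v) + (f x *\<^sub>R fst (h' x v) + liouville (h x) (h' x v) *\<^sub>R fst (h x)))) (at x)"
      unfolding Geq by (intro has_derivative_add has_derivative_scaleR has_derivative_fst has_derivative_snd h f x)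
    then have "G' x = (\<lambda>v. snd (h' x v) + (f x *\<^sub>R fst (h' x v) + liouville (h x) (h' x v) *\<^sub>R fst (h x)))"
      using has_derivative_unique G[OF x(1)] by blast
    \<comment> \<open>The three summands contribute minus the Liouville form, zero, and the
      Liouville form.\<close>
    then have normal: "\<nu> q \<bullet> G' x v = 0" for v
      by (simp add: \<nu>q inner_add_right T \<xi> hx liouville_eq)
    have "differential N k (\<lambda>q. q) q = G' x"
      unfolding x(2) by (rule differential_single_chart[OF k \<open>open R\<close> x(1)]) (rule G[OF x(1)])
    moreover have "{(U, \<phi>) \<in> {(N, k)}. q \<in> U} = {(N, k)}" using q by auto
    ultimately have tangent: "tangent_space {(N, k)} q = range (G' x)"
      unfolding tangent_space_def by simp
    have qeq: "q = \<eta> + f x *\<^sub>R \<xi>" by (simp add: x Geq hx)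
    \<comment> \<open>As \<xi> is a unit vector orthogonal to \<eta>, the projection in \<Phi>
      removes exactly \<open>f x *\<^sub>R \<xi>\<close> and leaves \<eta>.\<close>
    then have "\<xi> \<bullet> q = f x" by (simp add: inner_add_right \<xi>)
    then have "\<Phi> \<nu> q = (\<xi>, q - f x *\<^sub>R \<xi>)" by (simp add: \<Phi>_def \<nu>q)
    then have "\<Phi> \<nu> q = h x" by (simp add: hx) (simp add: qeq)
    then show ?thesis
      using \<Gamma>(1) x(1) \<xi> normal by (auto simp: \<nu>q tangent)
  qed
  ultimately show ?thesis
    using imm unfolding orthogonal_submanifold_def by (intro conjI exI[of _ \<nu>]) auto
qed

text \<open>Equality of dimensions is expressed by types: the atlas \<open>B\<close> has the same
  model space \<open>'m\<close> as \<open>A\<close>.\<close>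

theorem proposition3:
  fixes \<Gamma> :: "('a::euclidean_space \<times> 'a) set"
    and T :: "('a \<times> 'a) topology"
    and A :: "('a \<times> 'a, 'm::euclidean_space) atlas"
    and p \<xi>\<^sub>0 \<eta>\<^sub>0 :: 'a and r\<^sub>0 :: real
  assumes "\<Gamma> \<subseteq> TSphere"
    and "immersed_submanifold \<Gamma> T A"
    and "isotropic \<Gamma> A"
    and "DIM('m) > 0"
    and "p \<in> \<Psi> ` (\<Gamma> \<times> UNIV)"
    and "\<not> focal_point \<Gamma> A p"
    and "((\<xi>\<^sub>0, \<eta>\<^sub>0), r\<^sub>0) \<in> \<Gamma> \<times> UNIV"
    and "p = \<Psi> ((\<xi>\<^sub>0, \<eta>\<^sub>0), r\<^sub>0)"
  shows "\<exists>W (F :: 'a \<times> 'a \<Rightarrow> real) \<Sigma>\<^sub>0 S (B :: ('a, 'm) atlas).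
           openin T W \<and> smooth_on A W F \<and> is_differential_on A W F liouville \<and>
           (\<xi>\<^sub>0, \<eta>\<^sub>0) \<in> W \<and> F (\<xi>\<^sub>0, \<eta>\<^sub>0) = r\<^sub>0 \<and>
           \<Sigma>\<^sub>0 = \<Psi> ` {((\<xi>, \<eta>), F (\<xi>, \<eta>)) | \<xi> \<eta>. (\<xi>, \<eta>) \<in> W} \<and>
           p \<in> \<Sigma>\<^sub>0 \<and> orthogonal_submanifold \<Gamma> \<Sigma>\<^sub>0 S B"
proof -

  \<comment> \<open>The inclusion of \<Gamma> read in a chart at the given point\<close>
  define q0 where "q0 = (\<xi>\<^sub>0, \<eta>\<^sub>0)"
  have M: "C2_manifold T A" and T: "topspace T = \<Gamma>" and sm: "smooth_on A \<Gamma> (\<lambda>q. q)"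
    using assms(2) by (auto simp: immersed_submanifold_def)
  have q0: "q0 \<in> \<Gamma>" using assms(7) by (simp add: q0_def)
  have "(\<Union>(U, \<phi>)\<in>A. U) = \<Gamma>" using M T by (simp add: C2_manifold_def)
  then obtain U \<phi> where U: "(U, \<phi>) \<in> A" and q0U: "q0 \<in> U" using q0 by blast
  have U\<Gamma>: "U \<subseteq> \<Gamma>" using openin_subset[OF chart_domain_open[OF M U]] T by simp
  note inj = chart_inj[OF M U]
  define h where "h = inv_into U \<phi>"
  define D where "D = \<phi> ` U"
  define x0 where "x0 = \<phi> q0"
  have D: "open D" "x0 \<in> D" using chart_range_open[OF M U] q0U by (auto simp: D_def x0_def)
  have hU: "h x \<in> U" "\<phi> (h x) = x" if "x \<in> D" for x
    using that unfolding h_def D_def by (simp_all add: inv_into_into f_inv_into_f)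
  have h\<phi>: "h (\<phi> q) = q" if "q \<in> U" for q using that inj by (simp add: h_def)
  have hx0: "h x0 = q0" by (simp add: x0_def h\<phi> q0U)
  have hC2: "C2_on D h"
    using sm U U\<Gamma> unfolding smooth_on_def D_def h_def by (auto simp: o_def Int_absorb2)
  obtain h' where h': "\<And>x. x \<in> D \<Longrightarrow> (h has_derivative blinfun_apply (h' x)) (at x)"
    and h'C1: "C1_on D h'" using C2_onE[OF hC2] by blast
  have dh: "differential U \<phi> (\<lambda>q. q) (h x) = blinfun_apply (h' x)" if "x \<in> D" for x
    unfolding differential_def hU(2)[OF that] using frechet_derivative_at[OF h'[OF that]]
    by (simp add: h_def o_def)
  \<comment> \<open>By \<open>dh\<close>, values of \<open>h' x\<close> are tangent vectors of
    \<Gamma>, so isotropy applies to them.\<close>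
  have iso: "symplectic_form (h x) (h' x u) (h' x v) = 0" if "x \<in> D" for x u v
  proof -
    have "h' x w \<in> tangent_space A (h x)" for w
      unfolding tangent_space_def by (rule UN_I[of "(U, \<phi>)"]) (use U hU(1)[OF that] dh[OF that] in auto)
    then show ?thesis
      using assms(3) hU(1)[OF that] U\<Gamma> unfolding isotropic_def by blast
  qed

  \<comment> \<open>A primitive of the Liouville form in the chart\<close>
  obtain \<omega> \<omega>' where \<omega>: "\<And>x v. blinfun_apply (\<omega> x) v = fst (h' x v) \<bullet> snd (h x)" and \<omega>C1: "C1_on D \<omega>"
    and d\<omega>: "\<And>x. x \<in> D \<Longrightarrow> (\<omega> has_derivative blinfun_apply (\<omega>' x)) (at x)" and c\<omega>: "continuous_on D \<omega>'"
    and closed: "\<And>x u v. x \<in> D \<Longrightarrow> blinfun_apply (\<omega>' x u) v = blinfun_apply (\<omega>' x v) u"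
    using liouville_pullback_closed[OF D(1) h' h'C1 iso] by blast
  obtain r where r: "r > 0" "ball x0 r \<subseteq> D" using D openE by blast
  \<comment> \<open>The constant of integration is chosen so that \<open>G x0 = p\<close> for the
    map \<open>G\<close> below.\<close>
  obtain f where f: "\<And>x. x \<in> ball x0 r \<Longrightarrow> (f has_derivative blinfun_apply (\<omega> x)) (at x)" and f0: "f x0 = r\<^sub>0"
    using closed_one_form_exact_on_ball[OF d\<omega> continuous_on_subset[OF c\<omega> r(2)] closed r(1)] r(2) by blast
  have fC2: "C2_on (ball x0 r) f"
    by (rule C2_onI[OF f C1_on_subset[OF \<omega>C1 r(2)]])
  have hC2r: "C2_on (ball x0 r) h" by (rule C2_on_subset[OF hC2 r(2)])

  \<comment> \<open>The parametrization and its restriction to an embedding\<close>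
  define G where "G x = \<Psi> (h x, f x)" for x
  have Geq: "G = (\<lambda>x. snd (h x) + f x *\<^sub>R fst (h x))"
    by (simp add: G_def \<Psi>_def split_beta fun_eq_iff)
  have GC2: "C2_on (ball x0 r) G"
    unfolding Geq by (intro C2_on_add C2_on_linear[OF bounded_linear_snd] C2_on_linear[OF bounded_linear_fst]
        C2_on_bilinear[OF bounded_bilinear_scaleR] hC2r fC2)
  obtain G' where G': "\<And>x. x \<in> ball x0 r \<Longrightarrow> (G has_derivative blinfun_apply (G' x)) (at x)"
    and cG': "C1_on (ball x0 r) G'" using C2_onE[OF GC2] by blast
  have x0r: "x0 \<in> ball x0 r" using r by simp
  \<comment> \<open>A kernel vector \<open>v\<close> yields the kernel vector
    \<open>(v, \<omega> x0 v)\<close> of the differential of \<Psi> at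
    \<open>(h x0, r\<^sub>0)\<close>. Since \<open>p\<close> is not focal, \<Psi> is an immersion at
    every preimage of \<open>p\<close>, in particular at this one.\<close>
  have "G' x0 v = 0 \<Longrightarrow> v = 0" for v
  proof -
    assume v: "G' x0 v = 0"
    have "(G has_derivative (\<lambda>v. snd (h' x0 v) + (f x0 *\<^sub>R fst (h' x0 v) + \<omega> x0 v *\<^sub>R fst (h x0)))) (at x0)"
      unfolding Geq
      by (intro has_derivative_add has_derivative_scaleR has_derivative_fst has_derivative_snd h' f D x0r)
    from fun_cong[OF has_derivative_unique[OF this G'[OF x0r]], of v] v
    have "snd (h' x0 v) + \<omega> x0 v *\<^sub>R fst (h x0) + r\<^sub>0 *\<^sub>R fst (h' x0 v) = 0"
      by (simp add: f0 algebra_simps)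
    moreover have "\<forall>z\<in>\<Gamma> \<times> UNIV. \<Psi> z = p \<longrightarrow> immersion_at (times_line_atlas A) \<Psi> z"
      using assms(5,6) unfolding focal_point_def by blast
    from bspec[OF this assms(7)] have "immersion_at (times_line_atlas A) \<Psi> (h x0, r\<^sub>0)"
      by (simp add: assms(8) hx0 q0_def)
    ultimately show "v = 0"
      using nonfocal_chart[OF M U _ h'[OF D(2), unfolded h_def]] D(2) by (simp add: D_def h_def)
  qed
  then have "inj (blinfun_apply (G' x0))"
    by (simp add: linear_injective_0 bounded_linear.linear blinfun.bounded_linear_right)
  then obtain c e where c: "c > 0" and e: "e > 0" "ball x0 e \<subseteq> ball x0 r"
    and below: "\<And>x v. x \<in> ball x0 e \<Longrightarrow> c * norm v \<le> norm (G' x v)"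
    and exp: "\<And>x y. x \<in> ball x0 e \<Longrightarrow> y \<in> ball x0 e \<Longrightarrow> c * norm (x - y) \<le> norm (G x - G y)"
    using immersion_locally_bounded_below[OF open_ball x0r G' C1_on_imp_continuous_on[OF cG']] by blast
  define R where "R = ball x0 e"
  have R: "open R" "x0 \<in> R" "R \<subseteq> ball x0 r" "R \<subseteq> D" using e r by (auto simp: R_def)
  have Rr: "x \<in> ball x0 r" "x \<in> D" if "x \<in> R" for x using that R by auto
  have inj': "inj (blinfun_apply (G' x))" if "x \<in> R" for x
  proof -
    have "G' x v = 0 \<Longrightarrow> v = 0" for v
      using below[of x v] that c by (simp add: R_def mult_le_0_iff)
    then show ?thesis
      by (simp add: linear_injective_0 bounded_linear.linear blinfun.bounded_linear_right)
  qed
  have "continuous_on R G"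
    using C1_on_imp_continuous_on[OF C2_on_imp_C1_on[OF GC2]] R continuous_on_subset by blast
  then have k: "homeomorphism R (G ` R) G (inv_into R G)"
    by (rule expanding_homeomorphism[OF _ c]) (use exp in \<open>auto simp: R_def\<close>)

  \<comment> \<open>The domain and the function carried back to \<Gamma>\<close>
  define W where "W = h ` R"
  define F where "F = f \<circ> \<phi>"
  have WU: "W \<subseteq> U" using R hU by (auto simp: W_def)
  have \<phi>W: "\<phi> ` W = R" using hU(2)[OF Rr(2)] by (force simp: W_def image_image)
  have Fh: "F (h x) = f x" if "x \<in> R" for x using hU(2)[OF Rr(2)[OF that]] by (simp add: F_def)
  have "openin T W"
    using openin_iff_chart_image_open[OF M U WU] R by (simp add: \<phi>W)
  moreover have "smooth_on A W F"
    unfolding F_def by (rule smooth_on_chart_compose[OF M U WU]) (simp add: \<phi>W C2_on_subset[OF fC2] R)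
  moreover have "is_differential_on A W F liouville"
  proof (rule is_differential_on_chart[OF M U WU])
    fix q assume "q \<in> W"
    then obtain x where x: "x \<in> R" "q = h x" by (auto simp: W_def)
    have \<phi>q: "\<phi> q = x" using hU(2) Rr x by simp
    have dF: "((F \<circ> inv_into U \<phi>) has_derivative \<omega> x) (at (\<phi> q))"
      unfolding \<phi>q
      by (rule has_derivative_transform_within_open[OF f[OF Rr(1)[OF x(1)]] R(1) x(1)])
        (simp add: Fh flip: h_def)
    then show "(F \<circ> inv_into U \<phi>) differentiable at (\<phi> q)" by (auto simp: differentiable_def)
    show "inv_into U \<phi> differentiable at (\<phi> q)"
      using h'[OF Rr(2)[OF x(1)]] unfolding \<phi>q h_def by (auto simp: differentiable_def)
    fix v
    have "differential U \<phi> F q = \<omega> x"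
      unfolding differential_def by (rule frechet_derivative_at[OF dF, symmetric])
    then show "liouville q (differential U \<phi> (\<lambda>q. q) q v) = differential U \<phi> F q v"
      by (simp add: x(2) dh[OF Rr(2)[OF x(1)]] liouville_eq \<omega>)
  qed
  moreover have "(\<xi>\<^sub>0, \<eta>\<^sub>0) \<in> W"
    using R(2) hx0 unfolding W_def q0_def[symmetric] by (metis imageI)
  moreover have F0: "F (\<xi>\<^sub>0, \<eta>\<^sub>0) = r\<^sub>0"
    using Fh[OF R(2)] by (simp add: hx0 f0 q0_def[symmetric])
  moreover have "G ` R = \<Psi> ` {((\<xi>, \<eta>), F (\<xi>, \<eta>)) | \<xi> \<eta>. (\<xi>, \<eta>) \<in> W}"
  proof -
    have "{((\<xi>, \<eta>), F (\<xi>, \<eta>)) | \<xi> \<eta>. (\<xi>, \<eta>) \<in> W} = (\<lambda>q. (q, F q)) ` W" by auto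
    then show ?thesis by (simp add: W_def image_image G_def Fh)
  qed
  moreover have "p \<in> G ` R"
    using R(2) assms(8) f0 hx0 by (force simp: G_def q0_def)
  \<comment> \<open>The witnesses \<open>S\<close> and \<open>B\<close> are the subspace topology
    and the single chart inverse to \<open>G\<close>, which takes values in
    \<open>'m\<close>.\<close>
  moreover have "orthogonal_submanifold \<Gamma> (G ` R) (top_of_set (G ` R)) {(G ` R, inv_into R G)}"
  proof (rule orthogonal_submanifold_parametrized[OF G_def R(1), where h' = "\<lambda>x. blinfun_apply (h' x)"
          and G' = "\<lambda>x. blinfun_apply (G' x)"])
    show "C2_on R h" "C2_on R f" by (intro C2_on_subset[OF hC2] C2_on_subset[OF fC2] R)+
    show "h ` R \<subseteq> \<Gamma>" using WU U\<Gamma> by (simp add: W_def)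
    show "(f has_derivative (\<lambda>v. liouville (h x) (h' x v))) (at x)" if "x \<in> R" for x
      using f[OF Rr(1)[OF that]] by (simp add: liouville_eq \<omega>[symmetric])
  qed (simp_all add: assms(1) h' Rr inj' k G'[OF Rr(1)])
  ultimately show ?thesis by blast
qed

end
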